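(* Let $V:\mathfrak{C}\to\mathfrak{U}$ be a game value map, where $v_T,w_\lambda\in\mathfrak{C}$ for all $T,\lambda>0$. Let a family of functions $U_T\in\mathfrak{U}$ $(T>0)$ be a subsolution for the payoffs $v_T$, and let the family of functions $V[w_\lambda]$ $(\lambda>0)$ be a supersolution for the payoffs $w_\lambda$. Further, let $U_T$ $(T>0)$ satisfy $$\limsup_{T\uparrow\infty}\ \sup_{p\in[1,p_0]}\ \sup_{\omega\in\Omega}\big(U_T(\omega)-U_{Tp}(\omega)\big)\le 0\qquad\forall p_0>1.$$ Then for every $\varepsilon>0$ there exists a natural $N$ such that $$V[w_\lambda](\omega)\ge U_{1/\lambda}(\omega)-\varepsilon\qquad\forall\omega\in\Omega,\ \lambda\in(0,1/N).$$
   Context: Setting: $\mathbb{R}_+=[0,\infty)$. $\Omega$ is a nonempty set; $\mathbb{K}$ is a nonempty set of maps from $\mathbb{R}_+$ to $\Omega$; $g:\Omega\to[0,1]$ is such that for every $z\in\mathbb{K}$ the map $t\mapsto g(z(t))$ is Borel measurable. For $T,\lambda>0$ and $z\in\mathbb{K}$, $$v_T(z)=\frac1T\int_0^T g(z(t))\,dt,\qquad w_\lambda(z)=\lambda\int_0^\infty e^{-\lambda t}g(z(t))\,dt .$$ Game value map: $\mathfrak{U}$ is the set of all bounded maps $\Omega\to\mathbb{R}$. $\mathfrak{C}$ is a nonempty set of maps $\mathbb{K}\to\mathbb{R}$ such that $Ac+B\in\mathfrak{C}$ for all $c\in\mathfrak{C}$, $A\ge0$, $B\in\mathbb{R}$.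 A map $V:\mathfrak{C}\to\mathfrak{U}$ is a game value map if (1) $V[Ac+B]=A\,V[c]+B$ for all $c\in\mathfrak{C}$, $A\ge 0$, $B\in\mathbb{R}$; and (2) for $c_1,c_2\in\mathfrak{C}$, if $c_1(z)\le c_2(z)$ for all $z\in\mathbb{K}$ then $V[c_1](\omega)\le V[c_2](\omega)$ for all $\omega\in\Omega$. Auxiliary payoffs: for $\lambda,T,h>0$ and $U_*:\Omega\to\mathbb{R}$, define for $z\in\mathbb{K}$ $$\zeta^{U_*}_{h,T}(z)=\frac{1}{T+h}\int_0^h g(z(t))\,dt+\frac{T}{T+h}U_*(z(h)),\qquad \xi^{U_*}_{h,\lambda}(z)=\lambda\int_0^h e^{-\lambda t}g(z(t))\,dt+e^{-\lambda h}U_*(z(h)).$$ Sub-/supersolutions: A family $U_T\in\mathfrak{U}$ $(T>0)$ is a subsolution (supersolution) for the payoffs $v_T$ $(T>0)$ if for every $\varepsilon>0$ there is a natural $\bar T$ such that for all natural $h,T>\bar T$ the payoff $\zeta^{U_T}_{h,T}$ lies in $\mathfrak{C}$ and $U_{T+h}\le V[\zeta^{U_T}_{h,T}]+\varepsilon$ (respectively $U_{T+h}\ge V[\zeta^{U_T}_{h,T}]-\varepsilon$) on $\Omega$. A family $U_\lambda\in\mathfrak{U}$ $(\lambda>0)$ is a subsolution (supersolution) for the payoffs $w_\lambda$ $(\lambda>0)$ if for every $\varepsilon>0$ there is a natural $\bar T$ such that for all natural $h>\bar T$ and all positive $\lambda<1/\bar T$ the payoff $\xi^{U_\lambda}_{h,\lambda}$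 lies in $\mathfrak{C}$ and $U_\lambda\le V[\xi^{U_\lambda}_{h,\lambda}]+\varepsilon$ (respectively $U_\lambda\ge V[\xi^{U_\lambda}_{h,\lambda}]-\varepsilon$) on $\Omega$. *)

theory Defs
  imports "HOL-Analysis.Analysis"
begin

text \<open>Maps with domain \<open>\<Omega>\<close>, \<open>\<real>\<^sub>+ = {0..}\<close> or \<open>K\<close> are HOL functions that are
  \<^const>\<open>undefined\<close> outside their domain, so that equality of HOL functions is equality of maps.\<close>

definition bounded_maps :: "'w set \<Rightarrow> ('w \<Rightarrow> real) set" where
  "bounded_maps \<Omega> = {u \<in> \<Omega> \<rightarrow>\<^sub>E UNIV. bounded (u ` \<Omega>)}"

definition trajectories :: "'w set \<Rightarrow> (real \<Rightarrow> 'w) set" where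
  "trajectories \<Omega> = {0..} \<rightarrow>\<^sub>E \<Omega>"

definition affine_payoff ::
  "(real \<Rightarrow> 'w) set \<Rightarrow> real \<Rightarrow> ((real \<Rightarrow> 'w) \<Rightarrow> real) \<Rightarrow> real \<Rightarrow> (real \<Rightarrow> 'w) \<Rightarrow> real" where
  "affine_payoff K A c B = (\<lambda>z\<in>K. A * c z + B)"

definition payoff_class ::
  "(real \<Rightarrow> 'w) set \<Rightarrow> ((real \<Rightarrow> 'w) \<Rightarrow> real) set \<Rightarrow> bool" where
  "payoff_class K C \<longleftrightarrow>
     C \<noteq> {} \<and> C \<subseteq> K \<rightarrow>\<^sub>E UNIV \<and> (\<forall>c\<in>C. \<forall>A\<ge>0. \<forall>B. affine_payoff K A c B \<in> C)"

definition game_value_map ::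
  "'w set \<Rightarrow> (real \<Rightarrow> 'w) set \<Rightarrow> ((real \<Rightarrow> 'w) \<Rightarrow> real) set \<Rightarrow>
   (((real \<Rightarrow> 'w) \<Rightarrow> real) \<Rightarrow> 'w \<Rightarrow> real) \<Rightarrow> bool" where
  "game_value_map \<Omega> K C V \<longleftrightarrow>
     V \<in> C \<rightarrow> bounded_maps \<Omega> \<and>
     (\<forall>c\<in>C. \<forall>A\<ge>0. \<forall>B. \<forall>\<omega>\<in>\<Omega>. V (affine_payoff K A c B) \<omega> = A * V c \<omega> + B) \<and>
     (\<forall>c1\<in>C. \<forall>c2\<in>C. (\<forall>z\<in>K. c1 z \<le> c2 z) \<longrightarrow> (\<forall>\<omega>\<in>\<Omega>. V c1 \<omega> \<le> V c2 \<omega>))"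

definition payoff_v ::
  "(real \<Rightarrow> 'w) set \<Rightarrow> ('w \<Rightarrow> real) \<Rightarrow> real \<Rightarrow> (real \<Rightarrow> 'w) \<Rightarrow> real" where
  "payoff_v K g T = (\<lambda>z\<in>K. (1 / T) * (LINT t:{0..T}|lborel. g (z t)))"

definition payoff_w ::
  "(real \<Rightarrow> 'w) set \<Rightarrow> ('w \<Rightarrow> real) \<Rightarrow> real \<Rightarrow> (real \<Rightarrow> 'w) \<Rightarrow> real" where
  "payoff_w K g l = (\<lambda>z\<in>K. l * (LINT t:{0..}|lborel. exp (- l * t) * g (z t)))"

definition zeta ::
  "(real \<Rightarrow> 'w) set \<Rightarrow> ('w \<Rightarrow> real) \<Rightarrow> ('w \<Rightarrow> real) \<Rightarrow> real \<Rightarrow> real \<Rightarrow> (real \<Rightarrow> 'w) \<Rightarrow> real" where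
  "zeta K g u h T =
     (\<lambda>z\<in>K. 1 / (T + h) * (LINT t:{0..h}|lborel. g (z t)) + T / (T + h) * u (z h))"

definition xi ::
  "(real \<Rightarrow> 'w) set \<Rightarrow> ('w \<Rightarrow> real) \<Rightarrow> ('w \<Rightarrow> real) \<Rightarrow> real \<Rightarrow> real \<Rightarrow> (real \<Rightarrow> 'w) \<Rightarrow> real" where
  "xi K g u h l =
     (\<lambda>z\<in>K. l * (LINT t:{0..h}|lborel. exp (- l * t) * g (z t)) + exp (- l * h) * u (z h))"

definition subsolution_v ::
  "'w set \<Rightarrow> (real \<Rightarrow> 'w) set \<Rightarrow> ('w \<Rightarrow> real) \<Rightarrow> ((real \<Rightarrow> 'w) \<Rightarrow> real) set \<Rightarrow>
   (((real \<Rightarrow> 'w) \<Rightarrow> real) \<Rightarrow> 'w \<Rightarrow> real) \<Rightarrow> (real \<Rightarrow> 'w \<Rightarrow> real) \<Rightarrow> bool" where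
  "subsolution_v \<Omega> K g C V U \<longleftrightarrow>
     (\<forall>T>0. U T \<in> bounded_maps \<Omega>) \<and>
     (\<forall>\<epsilon>>0. \<exists>Tb::nat. Tb > 0 \<and> (\<forall>(h::nat) (T::nat). h > Tb \<and> T > Tb \<longrightarrow>
        zeta K g (U (real T)) (real h) (real T) \<in> C \<and>
        (\<forall>\<omega>\<in>\<Omega>. U (real T + real h) \<omega> \<le> V (zeta K g (U (real T)) (real h) (real T)) \<omega> + \<epsilon>)))"

text \<open>Here \<open>Tb > 0\<close> cannot be dropped: since \<open>1 / 0 = 0\<close>, the choice \<open>Tb = 0\<close> would leave no
  \<open>l\<close> to check.\<close>

definition supersolution_w ::
  "'w set \<Rightarrow> (real \<Rightarrow> 'w) set \<Rightarrow> ('w \<Rightarrow> real) \<Rightarrow> ((real \<Rightarrow> 'w) \<Rightarrow> real) set \<Rightarrow>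
   (((real \<Rightarrow> 'w) \<Rightarrow> real) \<Rightarrow> 'w \<Rightarrow> real) \<Rightarrow> (real \<Rightarrow> 'w \<Rightarrow> real) \<Rightarrow> bool" where
  "supersolution_w \<Omega> K g C V U \<longleftrightarrow>
     (\<forall>l>0. U l \<in> bounded_maps \<Omega>) \<and>
     (\<forall>\<epsilon>>0. \<exists>Tb::nat. Tb > 0 \<and> (\<forall>(h::nat) (l::real). h > Tb \<and> 0 < l \<and> l < 1 / real Tb \<longrightarrow>
        xi K g (U l) (real h) l \<in> C \<and>
        (\<forall>\<omega>\<in>\<Omega>. U l \<omega> \<ge> V (xi K g (U l) (real h) l) \<omega> - \<epsilon>)))"

end

theory Submission imports Defs begin

text \<open>For small \<open>l\<close> put \<open>n = \<lceil>1 / l\<rceil>\<close>, \<open>h = \<lceil>d / l\<rceil>\<close> and \<open>T = n - h\<close>. The payoffs \<open>zeta\<close> with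
  \<open>(h, T)\<close> and \<open>xi\<close> with \<open>(h, l)\<close> differ by \<open>O(d\<^sup>2)\<close>, because \<open>1 / (T + h)\<close> is close to \<open>l\<close> and
  \<open>exp (- x) = 1 - x + O(x\<^sup>2)\<close>. Hence an upper bound \<open>D \<ge> 0\<close> for \<open>U (1 / l) - V w\<close>, inserted at
  time \<open>h\<close>, improves after one application of the sub- and the supersolution inequality to
  \<open>(1 - h / n) D + O(d\<^sup>2)\<close>. Taking for \<open>D\<close> the positive part of the supremum, and
  using \<open>h / n \<ge> d / 2\<close>, one gets \<open>D = O(d)\<close>.\<close>

section \<open>Integrability and bounds for the payoff integrals\<close>

lemma set_integrable_bounded_weight:
  fixes f k :: "real \<Rightarrow> real"
  assumes "f \<in> borel_measurable (restrict_space borel {0..})"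
    and f01: "\<And>t. t \<ge> 0 \<Longrightarrow> f t \<in> {0..1}"
    and "S \<subseteq> {0..}" "S \<in> sets borel" and k: "set_integrable lborel S k"
  shows "set_integrable lborel S (\<lambda>t. k t * f t)"
proof (rule set_integrable_bound[OF k])
  have "f \<in> borel_measurable (restrict_space borel S)"
    using measurable_restrict_mono[OF assms(1)] \<open>S \<subseteq> {0..}\<close> by blast
  then have "(\<lambda>t. indicator S t *\<^sub>R f t) \<in> borel_measurable borel"
    using \<open>S \<in> sets borel\<close> by (subst (asm) borel_measurable_restrict_space_iff) auto
  moreover have "(\<lambda>t. indicator S t *\<^sub>R k t) \<in> borel_measurable borel"
    using k unfolding set_integrable_def by auto
  \<comment> \<open>Measurability of \<open>f\<close> is given only on the half-line, so both
    factors are extended by zero outside \<open>S\<close>; cutting off twice leaves the product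
    unchanged.\<close>
  ultimately have "(\<lambda>t. (indicator S t *\<^sub>R k t) * (indicator S t *\<^sub>R f t)) \<in> borel_measurable borel"
    by simp
  also have "(\<lambda>t. (indicator S t *\<^sub>R k t) * (indicator S t *\<^sub>R f t)) =
      (\<lambda>t. indicator S t *\<^sub>R (k t * f t))"
    by (auto simp: indicator_def)
  finally show "set_borel_measurable lborel S (\<lambda>t. k t * f t)"
    unfolding set_borel_measurable_def by simp
  show "AE t in lborel. t \<in> S \<longrightarrow> norm (k t * f t) \<le> norm (k t)"
  proof (intro AE_I2 impI)
    fix t assume "t \<in> S"
    then have "\<bar>f t\<bar> \<le> 1" using f01[of t] \<open>S \<subseteq> {0..}\<close> by auto
    then show "norm (k t * f t) \<le> norm (k t)"
      by (simp add: abs_mult mult_left_le)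
  qed
qed

lemma exp_decay_integral:
  fixes l :: real
  assumes "l > 0"
  shows "set_integrable lborel {0..} (\<lambda>t. exp (- l * t))"
    and "(LINT t:{0..}|lborel. exp (- l * t)) = 1 / l"
proof -
  have "(\<lambda>t. exp (- l * t)) absolutely_integrable_on {0..}"
    using integrable_on_exp_minus_to_infinity[OF assms]
    by (intro nonnegative_absolutely_integrable_1) auto
  \<comment> \<open>The integral over the half-line is a \<open>lebesgue\<close> one; Borel
    measurability of the integrand brings integrability down to \<open>lborel\<close>.\<close>
  then show i: "set_integrable lborel {0..} (\<lambda>t. exp (- l * t))"
    unfolding set_integrable_def by (subst (asm) integrable_completion) auto
  show "(LINT t:{0..}|lborel. exp (- l * t)) = 1 / l"
    using set_borel_integral_eq_integral(2)[OF i] has_integral_exp_minus_to_infinity[OF assms, of 0]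
    by (simp add: integral_unique)
qed

text \<open>The discount density \<open>l * exp (- l * t)\<close> has total mass 1, so the payoff is
  a weighted mean of values of \<open>g\<close>.\<close>

lemma payoff_w_bounds:
  assumes "z \<in> K" "l > 0"
    and m: "(\<lambda>t. g (z t)) \<in> borel_measurable (restrict_space borel {0..})"
    and g01: "\<And>t. t \<ge> 0 \<Longrightarrow> g (z t) \<in> {0..1}"
  shows "payoff_w K g l z \<in> {0..1}"
proof -
  have "(LINT t:{0..}|lborel. exp (- l * t) * g (z t)) \<le> (LINT t:{0..}|lborel. exp (- l * t))"
    using exp_decay_integral(1)[OF \<open>l > 0\<close>] g01
    by (intro set_integral_mono set_integrable_bounded_weight[OF m]) (auto simp: mult_left_le)
  moreover have "(LINT t:{0..}|lborel. exp (- l * t) * g (z t)) \<ge> 0"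
    unfolding set_lebesgue_integral_def using g01
    by (intro integral_nonneg_AE) (auto simp: indicator_def)
  ultimately show ?thesis
    using \<open>z \<in> K\<close> \<open>l > 0\<close> unfolding exp_decay_integral(2)[OF \<open>l > 0\<close>]
    by (simp add: payoff_w_def pos_le_divide_eq mult.commute[of l])
qed

text \<open>Since \<open>1 - exp (- l * t) \<le> l * t \<le> l * h\<close> and
  \<open>f \<le> 1\<close>, discounting lowers the integrand by at most \<open>l * h\<close>;
  integration over length \<open>h\<close> makes this \<open>l * h\<^sup>2\<close>.\<close>

lemma discounted_integral_ge:
  fixes f :: "real \<Rightarrow> real"
  assumes m: "f \<in> borel_measurable (restrict_space borel {0..})"
    and f01: "\<And>t. t \<ge> 0 \<Longrightarrow> f t \<in> {0..1}" and "h \<ge> 0" "l \<ge> 0"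
  shows "(LINT t:{0..h}|lborel. f t) - l * h\<^sup>2 \<le> (LINT t:{0..h}|lborel. exp (- l * t) * f t)"
    and "(LINT t:{0..h}|lborel. f t) \<ge> 0"
proof -
  have c: "set_integrable lborel {0..h} (\<lambda>_. c)" for c :: real
    by (intro borel_integrable_atLeastAtMost') auto
  have i: "set_integrable lborel {0..h} f"
    using set_integrable_bounded_weight[OF m f01 _ _ c[of 1]] by auto
  have e: "set_integrable lborel {0..h} (\<lambda>t. exp (- l * t))"
    by (intro borel_integrable_atLeastAtMost' continuous_intros)
  have "(LINT t:{0..h}|lborel. f t) - l * h\<^sup>2 = (LINT t:{0..h}|lborel. f t - l * h)"
    using \<open>h \<ge> 0\<close> set_integral_diff(2)[OF i c[of "l * h"]]
    by (simp add: set_lebesgue_integral_def power2_eq_square)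
  also have "\<dots> \<le> (LINT t:{0..h}|lborel. exp (- l * t) * f t)"
  proof (intro set_integral_mono set_integral_diff(1) i c set_integrable_bounded_weight[OF m f01 _ _ e])
    fix t assume t: "t \<in> {0..h}"
    have "(1 - exp (- l * t)) * f t \<le> 1 - exp (- l * t)"
      using f01[of t] t \<open>l \<ge> 0\<close> by (intro mult_left_le) auto
    also have "\<dots> \<le> l * t" using exp_ge_add_one_self[of "- l * t"] by simp
    also have "\<dots> \<le> l * h" using t \<open>l \<ge> 0\<close> by (intro mult_left_mono) auto
    finally show "f t - l * h \<le> exp (- l * t) * f t" by (simp add: algebra_simps)
  qed auto
  finally show "(LINT t:{0..h}|lborel. f t) - l * h\<^sup>2 \<le> (LINT t:{0..h}|lborel. exp (- l * t) * f t)" .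
  show "(LINT t:{0..h}|lborel. f t) \<ge> 0"
    unfolding set_lebesgue_integral_def using f01
    by (intro integral_nonneg_AE) (auto simp: indicator_def)
qed

text \<open>Running payoffs are compared through \<open>1 / n \<le> l\<close> and the discounting
  loss, terminal weights through \<open>T / n \<le> exp (- l * h) + (l * h)\<^sup>2\<close>; each
  accounts for one \<open>(l * h)\<^sup>2\<close>. The excess \<open>D\<close> enters with weight
  \<open>T / n = 1 - h / n\<close>, the contraction factor.\<close>

lemma zeta_le_xi:
  fixes h l T n :: real
  assumes "z \<in> K"
    and m: "(\<lambda>t. g (z t)) \<in> borel_measurable (restrict_space borel {0..})"
    and g01: "\<And>t. t \<ge> 0 \<Longrightarrow> g (z t) \<in> {0..1}"
    and w01: "w (z h) \<in> {0..1}" and uw: "u (z h) \<le> w (z h) + D + e" and "e \<ge> 0"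
    and "l > 0" "h \<ge> 1" "T > 0"
    and n: "T + h = n" "1 \<le> l * n" "l * n \<le> 1 + l"
  shows "zeta K g u h T z \<le> xi K g w h l z + (1 - h / n) * D + e + 2 * (l * h)\<^sup>2"
proof -
  have "n > 0" using n(1) \<open>T > 0\<close> \<open>h \<ge> 1\<close> by simp
  have q: "T / n = 1 - h / n" "T / n \<ge> 0" "h / n \<ge> 0"
    using n(1) \<open>n > 0\<close> \<open>T > 0\<close> \<open>h \<ge> 1\<close> by (auto simp: field_simps)
  let ?I = "LINT t:{0..h}|lborel. g (z t)"
  let ?J = "LINT t:{0..h}|lborel. exp (- l * t) * g (z t)"
  have I: "?I - l * h\<^sup>2 \<le> ?J" "?I \<ge> 0"
    using discounted_integral_ge[OF m g01, of h l] \<open>h \<ge> 1\<close> \<open>l > 0\<close> by auto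
  have "1 / n * ?I \<le> l * ?I"
    using I(2) n(2) \<open>n > 0\<close> by (intro mult_right_mono) (auto simp: field_simps)
  also have "\<dots> \<le> l * (?J + l * h\<^sup>2)"
    using I(1) \<open>l > 0\<close> by (intro mult_left_mono) auto
  finally have A: "1 / n * ?I \<le> l * ?J + (l * h)\<^sup>2"
    by (simp add: algebra_simps power2_eq_square)
  \<comment> \<open>The rounding gap \<open>l * n - 1 \<le> l\<close> times
    \<open>h / n \<le> l * h\<close> gives \<open>l * (l * h)\<close>, which fits into
    \<open>(l * h)\<^sup>2\<close> because \<open>h \<ge> 1\<close>.\<close>
  have "l * h - h / n = (l * n - 1) * (h / n)"
    using \<open>n > 0\<close> by (simp add: field_simps)
  also have "\<dots> \<le> l * (l * h)"
  proof (intro mult_mono)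
    show "h / n \<le> l * h"
      using mult_right_mono[OF n(2), of h] \<open>h \<ge> 1\<close> \<open>n > 0\<close> by (simp add: field_simps)
  qed (use n(3) q(3) \<open>l > 0\<close> in auto)
  also have "\<dots> \<le> (l * h)\<^sup>2"
    using \<open>h \<ge> 1\<close> \<open>l > 0\<close> mult_left_mono[of 1 h "l * l * h"] by (simp add: power2_eq_square algebra_simps)
  finally have "T / n \<le> exp (- l * h) + (l * h)\<^sup>2"
    using q(1) exp_ge_add_one_self[of "- l * h"] by simp
  then have "T / n * w (z h) \<le> (exp (- l * h) + (l * h)\<^sup>2) * w (z h)"
    using w01 by (intro mult_right_mono) auto
  also have "\<dots> \<le> exp (- l * h) * w (z h) + (l * h)\<^sup>2"
    using w01 mult_left_le[of "w (z h)" "(l * h)\<^sup>2"] by (simp add: algebra_simps)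
  finally have B: "T / n * w (z h) \<le> exp (- l * h) * w (z h) + (l * h)\<^sup>2" .
  have "T / n * u (z h) \<le> T / n * (w (z h) + D + e)"
    using uw q(2) by (intro mult_left_mono)
  also have "\<dots> = T / n * w (z h) + T / n * D + T / n * e" by (simp add: algebra_simps)
  \<comment> \<open>The factor \<open>T / n\<close> is kept on \<open>D\<close>, where it yields the
    contraction, and estimated by 1 on \<open>e\<close>.\<close>
  also have "T / n * e \<le> e"
    using mult_right_mono[of "T / n" 1 e] q \<open>e \<ge> 0\<close> by simp
  finally have "T / n * u (z h) \<le> T / n * w (z h) + T / n * D + e" by simp
  then show ?thesis
    using A B \<open>z \<in> K\<close> unfolding zeta_def xi_def n(1) q(1)[symmetric] by simp
qed

section \<open>Order and translation properties of game value maps\<close>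

lemma game_value_mono:
  assumes "game_value_map \<Omega> K C V" "c1 \<in> C" "c2 \<in> C" "\<And>z. z \<in> K \<Longrightarrow> c1 z \<le> c2 z" "\<omega> \<in> \<Omega>"
  shows "V c1 \<omega> \<le> V c2 \<omega>"
  using assms by (simp add: game_value_map_def)

text \<open>Taking \<open>A = 0\<close> shows that constants belong to \<open>C\<close> and are
  fixed by \<open>V\<close>; monotonicity then traps \<open>V c\<close> between 0 and 1.\<close>

lemma game_value_in_unit_interval:
  assumes gv: "game_value_map \<Omega> K C V" and pc: "payoff_class K C"
    and c: "c \<in> C" "\<And>z. z \<in> K \<Longrightarrow> c z \<in> {0..1}" and "\<omega> \<in> \<Omega>"
  shows "V c \<omega> \<in> {0..1}"
proof -
  have C: "affine_payoff K 0 c B \<in> C" for B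
    using pc c(1) by (simp add: payoff_class_def)
  have eq: "V (affine_payoff K 0 c B) \<omega> = B" for B
    using gv c(1) \<open>\<omega> \<in> \<Omega>\<close> by (simp add: game_value_map_def)
  note mono = game_value_mono[OF gv _ _ _ \<open>\<omega> \<in> \<Omega>\<close>]
  show ?thesis
    using mono[OF C[of 0] c(1)] mono[OF c(1) C[of 1]] eq c(2)
    by (auto simp: affine_payoff_def)
qed

lemma game_value_le_add:
  assumes gv: "game_value_map \<Omega> K C V" and pc: "payoff_class K C"
    and c: "c1 \<in> C" "c2 \<in> C" "\<And>z. z \<in> K \<Longrightarrow> c1 z \<le> c2 z + B" and "\<omega> \<in> \<Omega>"
  shows "V c1 \<omega> \<le> V c2 \<omega> + B"
proof -
  have "affine_payoff K 1 c2 B \<in> C"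
    using pc c(2) by (simp add: payoff_class_def)
  moreover have "V (affine_payoff K 1 c2 B) \<omega> = V c2 \<omega> + B"
    using gv c(2) \<open>\<omega> \<in> \<Omega>\<close> by (simp add: game_value_map_def)
  ultimately show ?thesis
    using game_value_mono[OF gv c(1) _ _ \<open>\<omega> \<in> \<Omega>\<close>, of "affine_payoff K 1 c2 B"] c(3)
    by (simp add: affine_payoff_def)
qed

section \<open>Slow decrease and the choice of horizons\<close>

lemma eventually_slow_decrease:
  fixes U :: "real \<Rightarrow> 'w \<Rightarrow> real"
  assumes "Limsup at_top (\<lambda>T::real. SUP p\<in>{1..p0}. SUP \<omega>\<in>\<Omega>. ereal (U T \<omega> - U (T * p) \<omega>)) \<le> 0"
    and "e > 0"
  obtains T0 where "T0 > 0"
    "\<And>T S \<omega>. T \<ge> T0 \<Longrightarrow> T \<le> S \<Longrightarrow> S \<le> p0 * T \<Longrightarrow> \<omega> \<in> \<Omega> \<Longrightarrow> U T \<omega> \<le> U S \<omega> + e"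
proof -
  have "\<forall>\<^sub>F T in at_top. (SUP p\<in>{1..p0}. SUP \<omega>\<in>\<Omega>. ereal (U T \<omega> - U (T * p) \<omega>)) < ereal e"
    using assms unfolding Limsup_le_iff by (auto simp: zero_ereal_def)
  then obtain T1 where T1: "\<And>T. T \<ge> T1 \<Longrightarrow>
      (SUP p\<in>{1..p0}. SUP \<omega>\<in>\<Omega>. ereal (U T \<omega> - U (T * p) \<omega>)) < ereal e"
    by (auto simp: eventually_at_top_linorder)
  show thesis
  \<comment> \<open>The lower bound 1 makes \<open>T\<close> positive, so that
    \<open>p = S / T\<close> is a legitimate ratio in \<open>{1..p0}\<close>.\<close>
  proof (rule that[of "max T1 1"])
    fix T S \<omega> assume T: "T \<ge> max T1 1" "T \<le> S" "S \<le> p0 * T" "\<omega> \<in> \<Omega>"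
    have "ereal (U T \<omega> - U (T * (S / T)) \<omega>) \<le>
        (SUP p\<in>{1..p0}. SUP \<omega>\<in>\<Omega>. ereal (U T \<omega> - U (T * p) \<omega>))"
      using T by (intro SUP_upper2[where i="S / T"] SUP_upper2[where i=\<omega>]) (auto simp: field_simps)
    also have "\<dots> < ereal e" using T1 T by simp
    finally show "U T \<omega> \<le> U S \<omega> + e" using T by simp
  qed auto
qed

text \<open>Both solution inequalities are available only for natural horizons above a threshold,
  here \<open>M\<close>, so \<open>n\<close> and \<open>h\<close> are ceilings of
  \<open>1 / l\<close> and \<open>d / l\<close>. Rounding raises \<open>l * n\<close> and
  \<open>l * h\<close> by at most \<open>l\<close>, and \<open>l \<le> d\<close>.\<close>

lemma horizon_choice:
  fixes d l M :: real
  assumes "0 < d" "d \<le> 1 / 4" "0 < l" "l \<le> d" "M > 0" "2 * M * l < d" "2 * M * l < 1"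
  obtains h n :: nat where "1 \<le> l * real n" "l * real n \<le> 1 + l"
    "d \<le> l * real h" "l * real h \<le> 2 * d" "M < real h" "h < n"
    "M < real n - real h" "1 / l \<le> 2 * (real n - real h)"
proof -
  have "\<exists>k::nat. x \<le> real k \<and> real k \<le> x + 1" if "x \<ge> 0" for x :: real
    using that by (intro exI[of _ "nat \<lceil>x\<rceil>"]) simp
  moreover have "1 / l \<ge> 0" "d / l \<ge> 0" using assms(1,3) by auto
  ultimately obtain n h :: nat
    where n: "1 / l \<le> n" "n \<le> 1 / l + 1" and h: "d / l \<le> h" "h \<le> d / l + 1"
    by meson
  show thesis
  proof (rule that[of n h])
    show "1 \<le> l * real n" "l * real n \<le> 1 + l" and H: "d \<le> l * real h" and "l * real h \<le> 2 * d"
      using n h assms by (auto simp: field_simps)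
    have "l * (2 * M) < l * real h" using H assms(6) by (simp add: mult_ac)
    then have "2 * M < real h" using \<open>0 < l\<close> by (rule mult_left_less_imp_less[OF _ less_imp_le])
    then show "M < real h" using \<open>M > 0\<close> by simp
    \<comment> \<open>Because \<open>l \<le> d \<le> 1 / 4\<close>, \<open>h\<close> takes at most
      half of \<open>1 / l\<close>, which leaves at least the other half for
      \<open>n - h\<close>.\<close>
    have "(d + l) / l \<le> (1 / 2) / l" using assms by (intro divide_right_mono) auto
    then have "d / l + 1 \<le> (1 / l) / 2" using \<open>0 < l\<close> by (simp add: add_divide_distrib)
    then show D: "1 / l \<le> 2 * (real n - real h)" using n h by simp
    have "M < (1 / l) / 2" using assms by (simp add: field_simps)
    then show M: "M < real n - real h" using D by simp
    then show "h < n" using \<open>M > 0\<close> by linarith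
  qed
qed

section \<open>Bounding the excess of \<open>U (1 / l)\<close> over the discounted value\<close>

theorem proposition1:
  fixes \<Omega> :: "'w set"
    and K :: "(real \<Rightarrow> 'w) set"
    and g :: "'w \<Rightarrow> real"
    and C :: "((real \<Rightarrow> 'w) \<Rightarrow> real) set"
    and V :: "((real \<Rightarrow> 'w) \<Rightarrow> real) \<Rightarrow> 'w \<Rightarrow> real"
    and U :: "real \<Rightarrow> 'w \<Rightarrow> real"
  assumes "\<Omega> \<noteq> {}"
    and "K \<noteq> {}" and "K \<subseteq> trajectories \<Omega>"
    and "g \<in> \<Omega> \<rightarrow> {0..1}"
    and "\<And>z. z \<in> K \<Longrightarrow> (\<lambda>t. g (z t)) \<in> borel_measurable (restrict_space borel {0..})"
    and "payoff_class K C"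
    and "game_value_map \<Omega> K C V"
    and "\<And>T. T > 0 \<Longrightarrow> payoff_v K g T \<in> C"
    and "\<And>l. l > 0 \<Longrightarrow> payoff_w K g l \<in> C"
    and "subsolution_v \<Omega> K g C V U"
    and "supersolution_w \<Omega> K g C V (\<lambda>l. V (payoff_w K g l))"
    and "\<And>p0::real. p0 > 1 \<Longrightarrow>
      Limsup at_top (\<lambda>T::real. SUP p\<in>{1..p0}. SUP \<omega>\<in>\<Omega>. ereal (U T \<omega> - U (T * p) \<omega>)) \<le> 0"
  shows "\<forall>\<epsilon>>0. \<exists>N::nat. N > 0 \<and>
    (\<forall>\<omega>\<in>\<Omega>. \<forall>l\<in>{0<..<1 / real N}. V (payoff_w K g l) \<omega> \<ge> U (1 / l) \<omega> - \<epsilon>)"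
proof (intro allI impI)
  fix \<epsilon> :: real assume "\<epsilon> > 0"
  let ?W = "\<lambda>l. V (payoff_w K g l)"
  note meas = assms(5) and pc = assms(6) and gv = assms(7) and wC = assms(9)
  have zK: "z t \<in> \<Omega>" if "z \<in> K" "t \<ge> 0" for z t
    using that assms(3) by (auto simp: trajectories_def PiE_def)
  have gz: "g (z t) \<in> {0..1}" if "z \<in> K" "t \<ge> 0" for z t
    using zK[OF that] assms(4) by auto
  have W01: "?W l \<omega> \<in> {0..1}" if "l > 0" "\<omega> \<in> \<Omega>" for l \<omega>
    using game_value_in_unit_interval[OF gv pc wC[OF that(1)] payoff_w_bounds that(2)] that(1) meas gz
    by blast
  \<comment> \<open>The cap \<open>1 / 4\<close> is what \<open>horizon_choice\<close> asks for; 24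
    matches the final bound \<open>D \<le> 24 * d\<close>.\<close>
  define d where "d = min (\<epsilon> / 24) (1 / 4)"
  have d: "d > 0" "d \<le> 1 / 4" "24 * d \<le> \<epsilon>" using \<open>\<epsilon> > 0\<close> by (auto simp: d_def)
  \<comment> \<open>The tolerance has the order of \<open>(l * h)\<^sup>2\<close>, so division by
    the contraction gain \<open>d / 2\<close> still leaves an error of order
    \<open>d\<close>.\<close>
  define e where "e = d\<^sup>2"
  have "e > 0" using d by (simp add: e_def)
  obtain T1 :: nat where "T1 > 0" and sub: "\<And>h T :: nat. h > T1 \<Longrightarrow> T > T1 \<Longrightarrow>
      zeta K g (U (real T)) (real h) (real T) \<in> C \<and>
      (\<forall>\<omega>\<in>\<Omega>. U (real T + real h) \<omega> \<le> V (zeta K g (U (real T)) (real h) (real T)) \<omega> + e)"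
    using assms(10) \<open>e > 0\<close> unfolding subsolution_v_def by meson
  obtain T2 :: nat where "T2 > 0" and sup: "\<And>(h::nat) l. h > T2 \<Longrightarrow> 0 < l \<Longrightarrow> l < 1 / real T2 \<Longrightarrow>
      xi K g (?W l) (real h) l \<in> C \<and> (\<forall>\<omega>\<in>\<Omega>. ?W l \<omega> \<ge> V (xi K g (?W l) (real h) l) \<omega> - e)"
    using assms(11) \<open>e > 0\<close> unfolding supersolution_w_def by meson
  \<comment> \<open>Ratio 2 suffices, as \<open>1 / l \<le> 2 * T\<close> and
    \<open>n \<le> 2 * (1 / l)\<close> will hold.\<close>
  obtain T0 where "T0 > 0" and slow: "\<And>T S \<omega>. T \<ge> T0 \<Longrightarrow> T \<le> S \<Longrightarrow> S \<le> 2 * T \<Longrightarrow>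
      \<omega> \<in> \<Omega> \<Longrightarrow> U T \<omega> \<le> U S \<omega> + e"
    using eventually_slow_decrease[OF assms(12)[of 2] \<open>e > 0\<close>] by auto
  define M where "M = T0 + real T1 + real T2"
  have M: "M > 0" "M \<ge> T0" "M \<ge> real T1" "M \<ge> real T2"
    using \<open>T0 > 0\<close> by (auto simp: M_def)
  \<comment> \<open>The four summands yield, in this order, \<open>2 * M * l < d\<close>,
    \<open>2 * M * l < 1\<close>, \<open>l \<le> d\<close> and \<open>l < 1\<close>.\<close>
  obtain N :: nat where N: "real N > 2 * M / d + 2 * M + 1 / d + 1"
    using reals_Archimedean2 by blast
  have NM: "real N > 2 * M / d" "real N > 2 * M" "real N > 1 / d" "real N > 1"
    using N d(1) M(1) by (smt (verit) divide_pos_pos)+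
  have main: "U (1 / l) \<omega> - ?W l \<omega> \<le> \<epsilon>" if "\<omega> \<in> \<Omega>" "l \<in> {0<..<1 / real N}" for \<omega> l
  proof -
    have l: "l > 0" "l < 1 / real N" using that by auto
    have lN: "l * real N < 1" using l NM by (simp add: field_simps)
    have l_small: "l * x < 1" if "x < real N" for x
      using lN mult_strict_left_mono[OF that l(1)] by linarith
    have "l \<le> d" "2 * M * l < d" "2 * M * l < 1" "l < 1"
      using l_small[OF NM(3)] l_small[OF NM(1)] l_small[OF NM(2)] l_small[OF NM(4)] d(1)
      by (auto simp: field_simps)
    then obtain h n :: nat where hn: "1 \<le> l * real n" "l * real n \<le> 1 + l" "d \<le> l * real h"
        "l * real h \<le> 2 * d" "M < real h" "h < n" "M < real n - real h" "1 / l \<le> 2 * (real n - real h)"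
      using horizon_choice[OF d(1,2) l(1) _ M(1)] by metis
    define T where "T = n - h"
    have T: "real T = real n - real h" "real T + real h = real n" "T > T1" "h > T1" "h > T2" "h \<ge> 1"
      "real T \<ge> T0"
      using hn(5-7) M by (auto simp: T_def of_nat_diff)
    have "l < 1 / real T2"
      using l_small[of "real T2"] NM(2) M(1,4) \<open>T2 > 0\<close> by (simp add: field_simps)
    \<comment> \<open>The positive part gives \<open>D \<ge> 0\<close>, so that
      \<open>d / 2 \<le> h / n\<close> can later be multiplied by \<open>D\<close>.\<close>
    define D where "D = max 0 (SUP \<omega>\<in>\<Omega>. U (1 / l) \<omega> - ?W l \<omega>)"
    have "U (1 / l) \<in> bounded_maps \<Omega>"
      using assms(10) l(1) by (simp add: subsolution_v_def)
    then obtain B where B: "\<And>\<omega>. \<omega> \<in> \<Omega> \<Longrightarrow> U (1 / l) \<omega> \<le> B"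
      unfolding bounded_maps_def bounded_iff by (auto simp: abs_le_iff)
    have "bdd_above ((\<lambda>\<omega>. U (1 / l) \<omega> - ?W l \<omega>) ` \<Omega>)"
    proof (rule bdd_aboveI2[where M=B])
      fix \<omega> assume "\<omega> \<in> \<Omega>"
      then show "U (1 / l) \<omega> - ?W l \<omega> \<le> B" using B[of \<omega>] W01[OF l(1), of \<omega>] by auto
    qed
    then have D: "U (1 / l) \<omega> - ?W l \<omega> \<le> D" if "\<omega> \<in> \<Omega>" for \<omega>
      unfolding D_def using that by (intro max.coboundedI2 cSUP_upper)
    have "D \<ge> 0" by (simp add: D_def)
    have q: "h / n \<le> 1" "d / 2 \<le> h / n"
    proof -
      show "h / n \<le> 1" using hn(6) by simp
      have "d * n \<le> l * h * n" using hn(3) by (intro mult_right_mono) auto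
      also have "\<dots> = h * (l * n)" by simp
      also have "\<dots> \<le> real h * 2" using hn(2) \<open>l < 1\<close> by (intro mult_left_mono) auto
      finally show "d / 2 \<le> h / n" using hn(6) by (simp add: field_simps)
    qed
    have "(l * real h)\<^sup>2 \<le> (2 * d)\<^sup>2" using hn(4) l(1) by (intro power_mono) auto
    then have lh: "2 * (l * real h)\<^sup>2 \<le> 8 * e" by (simp add: e_def power_mult_distrib)
    \<comment> \<open>Of the \<open>12 * e\<close>, one is for moving from \<open>1 / l\<close> to
      \<open>n\<close>, one for the subsolution, one for moving from \<open>T\<close> to
      \<open>1 / l\<close> at time \<open>h\<close>, eight for \<open>2 * (l * h)\<^sup>2\<close>,
      one for the supersolution.\<close>
    have improve: "U (1 / l) \<omega> - ?W l \<omega> \<le> (1 - h / n) * D + 12 * e" if "\<omega> \<in> \<Omega>" for \<omega>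
    proof -
      have n1: "1 / l \<le> real n" "real n \<le> 2 * (1 / l)" "real T \<le> 1 / l" "T0 \<le> 1 / l"
      proof -
        show "1 / l \<le> real n" "real n \<le> 2 * (1 / l)"
          using hn(1,2) l(1) \<open>l < 1\<close> by (auto simp: field_simps)
        \<comment> \<open>As \<open>h \<ge> 1\<close>, subtracting \<open>h\<close> absorbs the
          overshoot of \<open>n\<close>, whence \<open>T \<le> 1 / l\<close>. The order matters:
          slow decrease bounds \<open>U\<close> only by its values at later times.\<close>
        have "l \<le> l * real h" using T(6) l(1) by simp
        then have "l * real T \<le> 1" using hn(2) unfolding T(1) by (simp add: right_diff_distrib)
        then show "real T \<le> 1 / l" using l(1) by (simp add: field_simps)
        then show "T0 \<le> 1 / l" using T(7) by simp
      qed
      have le: "zeta K g (U (real T)) (real h) (real T) z \<le>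
          xi K g (?W l) (real h) l z + ((1 - h / n) * D + 9 * e)" if "z \<in> K" for z
      proof -
        have \<Omega>: "z (real h) \<in> \<Omega>" using zK that by simp
        have "U (real T) (z h) \<le> U (1 / l) (z h) + e"
          by (rule slow[OF T(7) n1(3) hn(8)[folded T(1)] \<Omega>])
        then have "U (real T) (z h) \<le> ?W l (z h) + D + e" using D[OF \<Omega>] by simp
        then have "zeta K g (U (real T)) (real h) (real T) z \<le>
            xi K g (?W l) (real h) l z + (1 - h / n) * D + e + 2 * (l * real h)\<^sup>2"
          using that meas gz W01[OF l(1) \<Omega>] \<open>e > 0\<close> l(1) T(2,3,6) hn(1,2)
          by (intro zeta_le_xi) auto
        then show ?thesis using lh by simp
      qed
      have "U (1 / l) \<omega> \<le> U n \<omega> + e"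
        by (rule slow[OF n1(4,1,2) that])
      also have "\<dots> \<le> V (zeta K g (U (real T)) (real h) (real T)) \<omega> + 2 * e"
        using sub[OF T(4,3)] that unfolding T(2) by force
      also have "\<dots> \<le> V (xi K g (?W l) (real h) l) \<omega> + ((1 - h / n) * D + 9 * e) + 2 * e"
        using game_value_le_add[OF gv pc sub[OF T(4,3), THEN conjunct1]
          sup[OF T(5) l(1) \<open>l < 1 / real T2\<close>, THEN conjunct1] le that] by simp
      also have "\<dots> \<le> ?W l \<omega> + ((1 - h / n) * D + 12 * e)"
        using sup[OF T(5) l(1) \<open>l < 1 / real T2\<close>] that by force
      finally show ?thesis by simp
    qed
    \<comment> \<open>The bound is uniform in \<open>\<omega>\<close> and its right side is
      nonnegative, so it passes to \<open>D\<close> itself. Unfolding hits both sides;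
      \<open>fold\<close> restores \<open>D\<close> on the right.\<close>
    have "D \<le> (1 - h / n) * D + 12 * e"
      unfolding D_def
    proof (intro max.boundedI cSUP_least, fold D_def)
      show "0 \<le> (1 - h / n) * D + 12 * e" using q(1) \<open>D \<ge> 0\<close> \<open>e > 0\<close> by simp
    qed (use assms(1) improve in auto)
    then have "h / n * D \<le> 12 * e" by (simp add: algebra_simps)
    then have "d / 2 * D \<le> 12 * e" using mult_right_mono[OF q(2) \<open>D \<ge> 0\<close>] by linarith
    then have "D \<le> 24 * d" using d(1) by (simp add: e_def power2_eq_square)
    then show ?thesis using D[OF \<open>\<omega> \<in> \<Omega>\<close>] d(3) by simp
  qed
  show "\<exists>N::nat. N > 0 \<and>
    (\<forall>\<omega>\<in>\<Omega>. \<forall>l\<in>{0<..<1 / real N}. V (payoff_w K g l) \<omega> \<ge> U (1 / l) \<omega> - \<epsilon>)"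
    using main NM(4) by (intro exI[of _ N]) force
qed

end
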